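(* Let $n\in\mathbb{N}$ and let $L,C,R\in\mathbb{R}_{\max}^{n\times n}$. Consider the max-plus linear system $$\forall k\geq 2,\quad \bar{x}(k+1)=\bar{A}\otimes\bar{x}(k)\oplus\bar{B}\otimes u(k),\qquad \bar{A}=\begin{bmatrix}\mathcal{E}&E\\ \mathcal{E}&\mathcal{E}\end{bmatrix}\in\mathbb{R}_{\max}^{2n\times 2n},\quad \bar{B}=\begin{bmatrix}\mathcal{E}\\ E\end{bmatrix}\in\mathbb{R}_{\max}^{2n\times n},$$ and the semimodule $$\mathcal{K}=\{\bar{x}\in\mathbb{R}_{\max}^{2n}\mid \bar{x}\geq H\otimes\bar{x}\}=\operatorname{Im}H^*,\qquad H=\begin{bmatrix}C&L\\ R&C\end{bmatrix}.$$ Let $\mathcal{K}^*$ be the maximal $(\bar{A},\bar{B})$-invariant subsemimodule of $\mathcal{K}$, and let $\phi^k$ be the iterates of the map $\phi$ associated with $(\bar A,\bar B)$, with $\phi^\infty(\mathcal{K})=\lim_{k\to+\infty}\phi^k(\mathcal{K})$. Then $\phi^\infty(\mathcal{K})=\mathcal{K}^*$. Moreover, for all $k\in\mathbb{N}_0\cup\{\infty\}$, $\phi^k(\mathcal{K})=\operatorname{Im}S_{k+2}$, where $S_{k+2}$ is the top-left $2n\times 2n$ block of the matrix $M_{[k+2]}^*$ (with $\infty+2=\infty$).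
   Context: Max-plus algebra: $\mathbb{R}_{\max}=\mathbb{R}\cup\{-\infty\}$, $\overline{\mathbb{R}}=\mathbb{R}\cup\{-\infty,+\infty\}$; $\mathbb{N}$ is the set of positive integers and $\mathbb{N}_0=\mathbb{N}\cup\{0\}$. For $a,b\in\overline{\mathbb{R}}$, $a\oplus b=\max\{a,b\}$, and $a\otimes b=a+b$ if $a,b\in\mathbb{R}\cup\{+\infty\}$, $a\otimes b=-\infty$ if $a$ or $b$ is $-\infty$. For matrices with (possibly infinite) index sets, $(A\oplus B)_{ij}=A_{ij}\oplus B_{ij}$ and $(A\otimes C)_{ij}=\bigoplus_k A_{ik}\otimes C_{kj}$, where infinite $\oplus$-sums are suprema in $\overline{\mathbb{R}}$; the symbol $\otimes$ is often omitted. $\mathcal{E}$ is the matrix with all entries $-\infty$; $E$ is the max-plus identity ($0$ on the diagonal, $-\infty$ elsewhere). $\leq,\geq$ between matrices or vectors are entrywise. The Kleene star of a square matrix is $A^*=\bigoplus_{k=0}^{+\infty}A^k$, with $A^0=E$, $A^k=A^{k-1}\otimes A$. A semimodule is a subset of $\mathbb{R}_{\max}^n$ closed under finitely many additions $\oplus$ and under multiplication by scalars in $\mathbb{R}_{\max}$. For $U\in\overline{\mathbb{R}}^{n\times p}$, $\operatorname{Im}U=\{U\otimes u\mid u\in\mathbb{R}_{\max}^p\}$. Controlled invariance: given $A\in\mathbb{R}_{\max}^{N\times N}$, $B\in\mathbb{R}_{\max}^{N\times m}$ (here $N,m$ denote dimensions), a semimodule $\mathcal{X}\subseteq\mathbb{R}_{\max}^N$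 is $(A,B)$-invariant if for every initial vector in $\mathcal{X}$ there is a sequence of inputs in $\mathbb{R}_{\max}^m$ such that all subsequent states obtained through $x(k+1)=A\otimes x(k)\oplus B\otimes u(k)$ belong to $\mathcal{X}$. The maximal $(A,B)$-invariant subsemimodule of a semimodule $\mathcal{K}$ is the largest (with respect to inclusion) $(A,B)$-invariant semimodule contained in $\mathcal{K}$; it is the set of initial vectors for which there exists a sequence of inputs keeping the entire trajectory (including the initial vector) in $\mathcal{K}$. The map $\phi$ associated with $(\bar A,\bar B)$ is, for $\mathcal{X}\subseteq\mathbb{R}_{\max}^{2n}$, $\phi(\mathcal{X})=\mathcal{X}\cap\{x\in\mathbb{R}_{\max}^{2n}\mid(\exists u\in\mathbb{R}_{\max}^n)\ \bar{A}\otimes x\oplus\bar{B}\otimes u\in\mathcal{X}\}$. Its iterates are $\phi^0(\mathcal{X})=\mathcal{X}$ and $\phi^k(\mathcal{X})=\phi(\phi^{k-1}(\mathcal{X}))$ for $k\in\mathbb{N}$. Since $\phi^{k+1}(\mathcal{K})\subseteq\phi^k(\mathcal{K})$, the limit $\lim_{k\to+\infty}\phi^k(\mathcal{K})$ is $\bigcap_{k\in\mathbb{N}_0}\phi^k(\mathcal{K})$. For $K\in\mathbb{N}$, $M_{[K]}\in\mathbb{R}_{\max}^{Kn\times Kn}$ is the block tridiagonal matrix with $K\times K$ blocks of size $n\times n$ whose diagonal blocks are all $C$, whose blocks immediately above the diagonal (block positions $(i,i+1)$) are all $L$, whose blocks immediately below the diagonal (block positions $(i+1,i)$) are all $R$,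 and whose other blocks are $\mathcal{E}$. $M_{[\infty]}\in\mathbb{R}_{\max}^{\mathbb{N}\times\mathbb{N}}$ is the infinite matrix defined by the same block pattern, with block indices ranging over $\mathbb{N}$.
   Formalization: The equalities K = Im H* and φ^k(K) = Im S_{k+2} are stated only when H*, respectively S_{k+2} for that k, has no entry +∞; otherwise the image contains vectors outside R_max^{2n} and the equality is false (e.g. n=1, L=R=−∞, C=1). *)

theory Defs
  imports "HOL-Library.Extended_Real"
begin

(* The (possibly infinite) sum of the max-plus algebra is the supremum of the complete lattice
   ereal; on vectors and matrices, which are functions, sup and the order are entrywise.
   The product is not the addition of ereal, for which -\<infinity> + \<infinity> = \<infinity>. *)

definition mp_times :: "ereal \<Rightarrow> ereal \<Rightarrow> ereal" (infixl \<open>\<otimes>\<close> 70) where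
  "a \<otimes> b = (if a = -\<infinity> \<or> b = -\<infinity> then -\<infinity> else a + b)"

definition Rmax :: "ereal set" where
  "Rmax = {a. a \<noteq> \<infinity>}"

definition Rmax_vec :: "('i \<Rightarrow> ereal) set" where
  "Rmax_vec = {x. \<forall>i. x i \<in> Rmax}"

definition Rmax_mat :: "('i \<Rightarrow> 'j \<Rightarrow> ereal) set" where
  "Rmax_mat = {A. \<forall>i j. A i j \<in> Rmax}"

definition mp_zero :: "'i \<Rightarrow> 'j \<Rightarrow> ereal" where
  "mp_zero = (\<lambda>i j. -\<infinity>)"

definition mp_id :: "'i \<Rightarrow> 'i \<Rightarrow> ereal" where
  "mp_id = (\<lambda>i j. if i = j then 0 else -\<infinity>)"

(* The argument I is the index set of the rows and columns of the square matrices involved;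
   entries outside I \<times> I are irrelevant. It is needed for families of matrices of varying size. *)

definition mp_mult_on ::
    "'i set \<Rightarrow> ('i \<Rightarrow> 'i \<Rightarrow> ereal) \<Rightarrow> ('i \<Rightarrow> 'i \<Rightarrow> ereal) \<Rightarrow> 'i \<Rightarrow> 'i \<Rightarrow> ereal" where
  "mp_mult_on I A B = (\<lambda>i j. SUP k\<in>I. A i k \<otimes> B k j)"

primrec mp_pow_on :: "'i set \<Rightarrow> ('i \<Rightarrow> 'i \<Rightarrow> ereal) \<Rightarrow> nat \<Rightarrow> 'i \<Rightarrow> 'i \<Rightarrow> ereal" where
  "mp_pow_on I A 0 = mp_id"
| "mp_pow_on I A (Suc k) = mp_mult_on I (mp_pow_on I A k) A"

definition mp_star_on :: "'i set \<Rightarrow> ('i \<Rightarrow> 'i \<Rightarrow> ereal) \<Rightarrow> 'i \<Rightarrow> 'i \<Rightarrow> ereal" where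
  "mp_star_on I A = (\<lambda>i j. SUP k. mp_pow_on I A k i j)"

definition mp_mult_vec :: "('i \<Rightarrow> 'j \<Rightarrow> ereal) \<Rightarrow> ('j \<Rightarrow> ereal) \<Rightarrow> 'i \<Rightarrow> ereal" (infixr \<open>\<otimes>v\<close> 70) where
  "A \<otimes>v x = (\<lambda>i. SUP j. A i j \<otimes> x j)"

definition mp_Im :: "('i \<Rightarrow> 'j \<Rightarrow> ereal) \<Rightarrow> ('i \<Rightarrow> ereal) set" where
  "mp_Im U = {U \<otimes>v u | u. u \<in> Rmax_vec}"

definition semimodule :: "('i \<Rightarrow> ereal) set \<Rightarrow> bool" where
  "semimodule X \<longleftrightarrow>
     X \<subseteq> Rmax_vec \<and> (\<lambda>i. -\<infinity>) \<in> X \<and>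
     (\<forall>x\<in>X. \<forall>y\<in>X. sup x y \<in> X) \<and>
     (\<forall>c\<in>Rmax. \<forall>x\<in>X. (\<lambda>i. c \<otimes> x i) \<in> X)"

primrec trajectory ::
    "('i \<Rightarrow> 'i \<Rightarrow> ereal) \<Rightarrow> ('i \<Rightarrow> 'm \<Rightarrow> ereal) \<Rightarrow> ('i \<Rightarrow> ereal) \<Rightarrow> (nat \<Rightarrow> 'm \<Rightarrow> ereal) \<Rightarrow> nat \<Rightarrow> 'i \<Rightarrow> ereal" where
  "trajectory A B x0 u 0 = x0"
| "trajectory A B x0 u (Suc k) = sup (A \<otimes>v trajectory A B x0 u k) (B \<otimes>v u k)"

definition AB_invariant ::
    "('i \<Rightarrow> 'i \<Rightarrow> ereal) \<Rightarrow> ('i \<Rightarrow> 'm \<Rightarrow> ereal) \<Rightarrow> ('i \<Rightarrow> ereal) set \<Rightarrow> bool" where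
  "AB_invariant A B X \<longleftrightarrow>
     (\<forall>x0\<in>X. \<exists>u. (\<forall>k. u k \<in> Rmax_vec) \<and> (\<forall>k. trajectory A B x0 u k \<in> X))"

definition is_maximal_AB_invariant ::
    "('i \<Rightarrow> 'i \<Rightarrow> ereal) \<Rightarrow> ('i \<Rightarrow> 'm \<Rightarrow> ereal) \<Rightarrow> ('i \<Rightarrow> ereal) set \<Rightarrow> ('i \<Rightarrow> ereal) set \<Rightarrow> bool" where
  "is_maximal_AB_invariant A B K X \<longleftrightarrow>
     semimodule X \<and> AB_invariant A B X \<and> X \<subseteq> K \<and>
     (\<forall>Y. semimodule Y \<and> AB_invariant A B Y \<and> Y \<subseteq> K \<longrightarrow> Y \<subseteq> X)"

definition phi ::
    "('i \<Rightarrow> 'i \<Rightarrow> ereal) \<Rightarrow> ('i \<Rightarrow> 'm \<Rightarrow> ereal) \<Rightarrow> ('i \<Rightarrow> ereal) set \<Rightarrow> ('i \<Rightarrow> ereal) set" where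
  "phi A B X = X \<inter> {x \<in> Rmax_vec. \<exists>u\<in>Rmax_vec. sup (A \<otimes>v x) (B \<otimes>v u) \<in> X}"

definition phi_iter ::
    "('i \<Rightarrow> 'i \<Rightarrow> ereal) \<Rightarrow> ('i \<Rightarrow> 'm \<Rightarrow> ereal) \<Rightarrow> enat \<Rightarrow> ('i \<Rightarrow> ereal) set \<Rightarrow> ('i \<Rightarrow> ereal) set" where
  "phi_iter A B k X =
     (case k of enat j \<Rightarrow> (phi A B ^^ j) X | \<infinity> \<Rightarrow> (\<Inter>j. (phi A B ^^ j) X))"

(* The n indices are the elements of 'n; the 2n indices are 'n + 'n, first block Inl, second Inr. *)

definition block_2x2 ::
    "('n \<Rightarrow> 'n \<Rightarrow> ereal) \<Rightarrow> ('n \<Rightarrow> 'n \<Rightarrow> ereal) \<Rightarrow> ('n \<Rightarrow> 'n \<Rightarrow> ereal) \<Rightarrow> ('n \<Rightarrow> 'n \<Rightarrow> ereal)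
      \<Rightarrow> 'n + 'n \<Rightarrow> 'n + 'n \<Rightarrow> ereal" where
  "block_2x2 P Q S T = case_sum (\<lambda>i. case_sum (P i) (Q i)) (\<lambda>i. case_sum (S i) (T i))"

definition A_bar :: "'n + 'n \<Rightarrow> 'n + 'n \<Rightarrow> ereal" where
  "A_bar = block_2x2 mp_zero mp_id
                     mp_zero mp_zero"

definition B_bar :: "'n + 'n \<Rightarrow> 'n \<Rightarrow> ereal" where
  "B_bar = case_sum mp_zero mp_id"

definition H_mat ::
    "('n \<Rightarrow> 'n \<Rightarrow> ereal) \<Rightarrow> ('n \<Rightarrow> 'n \<Rightarrow> ereal) \<Rightarrow> ('n \<Rightarrow> 'n \<Rightarrow> ereal) \<Rightarrow> 'n + 'n \<Rightarrow> 'n + 'n \<Rightarrow> ereal" where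
  "H_mat L C R = block_2x2 C L
                           R C"

definition K_set ::
    "('n \<Rightarrow> 'n \<Rightarrow> ereal) \<Rightarrow> ('n \<Rightarrow> 'n \<Rightarrow> ereal) \<Rightarrow> ('n \<Rightarrow> 'n \<Rightarrow> ereal) \<Rightarrow> ('n + 'n \<Rightarrow> ereal) set" where
  "K_set L C R = {x \<in> Rmax_vec. x \<ge> H_mat L C R \<otimes>v x}"

(* The index (a, i) is row or column i of block a, blocks being numbered from 1. The block pattern
   does not depend on the number K of blocks, which enters only through the index set. *)

definition M_index :: "enat \<Rightarrow> (nat \<times> 'n) set" where
  "M_index K = {a. 1 \<le> a \<and> enat a \<le> K} \<times> UNIV"

definition M_mat ::
    "('n \<Rightarrow> 'n \<Rightarrow> ereal) \<Rightarrow> ('n \<Rightarrow> 'n \<Rightarrow> ereal) \<Rightarrow> ('n \<Rightarrow> 'n \<Rightarrow> ereal) \<Rightarrow> nat \<times> 'n \<Rightarrow> nat \<times> 'n \<Rightarrow> ereal" where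
  "M_mat L C R = (\<lambda>(a, i) (b, j).
     if b = a then C i j
     else if b = a + 1 then L i j
     else if a = b + 1 then R i j
     else -\<infinity>)"

definition top_left :: "(nat \<times> 'n \<Rightarrow> nat \<times> 'n \<Rightarrow> ereal) \<Rightarrow> 'n + 'n \<Rightarrow> 'n + 'n \<Rightarrow> ereal" where
  "top_left A = (\<lambda>p q. A (case_sum (Pair 1) (Pair 2) p) (case_sum (Pair 1) (Pair 2) q))"

definition S_mat ::
    "('n \<Rightarrow> 'n \<Rightarrow> ereal) \<Rightarrow> ('n \<Rightarrow> 'n \<Rightarrow> ereal) \<Rightarrow> ('n \<Rightarrow> 'n \<Rightarrow> ereal) \<Rightarrow> enat \<Rightarrow> 'n + 'n \<Rightarrow> 'n + 'n \<Rightarrow> ereal" where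
  "S_mat L C R K = top_left (mp_star_on (M_index K) (M_mat L C R))"

(* A Kleene star may have entries \<infinity>. The image of a matrix consists of vectors over Rmax only if the
   matrix itself has entries in Rmax, so that this condition is necessary in any equality between
   such an image and a subset of Rmax_vec. *)

lemma mp_Im_subset_Rmax_vec_iff:
  fixes U :: "'i \<Rightarrow> 'j::finite \<Rightarrow> ereal"
  shows "mp_Im U \<subseteq> Rmax_vec \<longleftrightarrow> U \<in> Rmax_mat"
proof
  assume sub: "mp_Im U \<subseteq> Rmax_vec"
  have "U i j \<noteq> \<infinity>" for i j
  proof -
    have "(\<lambda>l. mp_id l j) \<in> Rmax_vec"
      by (simp add: Rmax_vec_def Rmax_def mp_id_def)
    then have "U \<otimes>v (\<lambda>l. mp_id l j) \<in> Rmax_vec"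
      using sub by (auto simp: mp_Im_def)
    then have "(SUP l. U i l \<otimes> mp_id l j) \<noteq> \<infinity>"
      by (simp add: Rmax_vec_def Rmax_def mp_mult_vec_def)
    moreover have "U i j \<otimes> mp_id j j \<le> (SUP l. U i l \<otimes> mp_id l j)"
      by (rule SUP_upper) simp
    ultimately show ?thesis
      by (auto simp: mp_times_def mp_id_def)
  qed
  then show "U \<in> Rmax_mat"
    by (simp add: Rmax_mat_def Rmax_def)
next
  assume U: "U \<in> Rmax_mat"
  have "(SUP j. U i j \<otimes> u j) \<noteq> \<infinity>" if u: "u \<in> Rmax_vec" for u i
  proof -
    have "(SUP j. U i j \<otimes> u j) \<in> range (\<lambda>j. U i j \<otimes> u j)"
      using Max_in[of "range (\<lambda>j. U i j \<otimes> u j)"] by (simp add: Max_Sup)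
    then show ?thesis
      using U u by (auto simp: Rmax_mat_def Rmax_vec_def Rmax_def mp_times_def)
  qed
  then show "mp_Im U \<subseteq> Rmax_vec"
    by (auto simp: mp_Im_def mp_mult_vec_def Rmax_vec_def Rmax_def)
qed

end

theory Submission imports Defs begin

text \<open>
  A step of the system replaces a state \<open>(x\<^sub>1, x\<^sub>2)\<close> by \<open>(x\<^sub>2, u)\<close> with \<open>u\<close> chosen freely. So a trajectory
  is a sequence of vectors \<open>x\<^sub>1, x\<^sub>2, x\<^sub>3, \<dots>\<close> read through a window of width two, and all its states lie in
  \<open>\<K>\<close> if and only if the stacked vector \<open>v = (x\<^sub>1, x\<^sub>2, \<dots>)\<close> satisfies \<open>v \<ge> M v\<close>, where \<open>M\<close> is the block
  tridiagonal matrix. Hence \<open>\<phi>\<^sup>k(\<K>)\<close> consists of the first windows of the solutions with \<open>k + 2\<close> blocks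
  (\<open>phi_power_eq_extensible\<close>).

  Since \<open>v \<ge> M v\<close> implies \<open>v \<ge> M\<^sup>* v\<close>, a first window \<open>x\<close> satisfies \<open>x \<ge> S x\<close>, and for the idempotent matrix
  \<open>S\<close> this means \<open>x \<in> Im S\<close>. The converse inclusion is not immediate, because only the corner \<open>S\<close> of \<open>M\<^sup>*\<close> is
  assumed to have no entry \<open>\<infinity>\<close>, and not the blocks that would give \<open>x\<^sub>3, x\<^sub>4, \<dots>\<close>. For finitely many blocks
  it is proved by induction on their number, extending \<open>x\<close> by a single block at each step
  (\<open>mp_Im_S_mat_subset_phi_power\<close>).

  The remaining point is that a state in every \<open>\<phi>\<^sup>k(\<K>)\<close>, which has extensions of every finite length,
  has an infinite one (\<open>extensible_infinity\<close>). The set of extensions is closed under infima, so there is a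
  least one of each length, and the least ones increase with the length. Their limit is a solution on all
  blocks, but it might take the value \<open>\<infinity>\<close>. That this does not happen rests on the translation invariance
  of \<open>M\<close>. An infinite extension provides inputs that never leave the limit of the iterates, which is therefore
  the maximal invariant subsemimodule. It also provides the inclusion of this limit in the image of the
  corner of \<open>M\<^sup>*\<close> for infinitely many blocks. The reverse inclusion follows from the finite case, because the
  corners increase with the number of blocks and their images therefore decrease.
\<close>

section \<open>Max-plus matrices and Kleene stars\<close>

lemma mp_times_commute: "a \<otimes> b = b \<otimes> a"
  by (simp add: mp_times_def add.commute)

lemma mp_times_assoc: "(a \<otimes> b) \<otimes> c = a \<otimes> (b \<otimes> c)"
  by (cases a; cases b; cases c) (auto simp: mp_times_def)

lemma mp_times_mono: "a \<le> a' \<Longrightarrow> b \<le> b' \<Longrightarrow> a \<otimes> b \<le> a' \<otimes> b'"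
  by (auto simp: mp_times_def intro: add_mono)

lemma mp_times_simps [simp]:
  "-\<infinity> \<otimes> a = -\<infinity>" "a \<otimes> -\<infinity> = -\<infinity>" "0 \<otimes> a = a" "a \<otimes> 0 = a"
  by (auto simp: mp_times_def)

lemma mp_times_PInfty: "a \<noteq> -\<infinity> \<Longrightarrow> a \<otimes> \<infinity> = \<infinity>"
  by (simp add: mp_times_def)

lemma mp_times_Rmax: "a \<in> Rmax \<Longrightarrow> b \<in> Rmax \<Longrightarrow> a \<otimes> b \<in> Rmax"
  by (simp add: mp_times_def Rmax_def)

text \<open>
  Multiplication by a real number is a residuated map. The factor \<open>\<infinity>\<close> has to be treated apart: it sends
  every element other than \<open>-\<infinity>\<close> to \<open>\<infinity>\<close>.
\<close>

lemma SUP_mp_times_leI: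
  assumes le: "\<And>k. k \<in> I \<Longrightarrow> f k \<otimes> c \<le> d"
  shows "(SUP k\<in>I. f k) \<otimes> c \<le> d"
proof (cases c)
  case (real r)
  have res: "a \<otimes> c \<le> d \<longleftrightarrow> a \<le> d - c" for a
    using real by (cases a; cases d) (auto simp: mp_times_def)
  show ?thesis
    using le unfolding res by (rule SUP_least)
next
  case PInf
  show ?thesis
  proof (cases "\<exists>k\<in>I. f k \<noteq> -\<infinity>")
    case True
    then show ?thesis
      using le PInf by (fastforce simp: mp_times_PInfty)
  next
    case False
    then have "(SUP k\<in>I. f k) \<le> -\<infinity>"
      by (intro SUP_least) auto
    then show ?thesis by simp
  qed
qed simp

lemma mp_times_SUP_leI:
  "(\<And>k. k \<in> I \<Longrightarrow> c \<otimes> f k \<le> d) \<Longrightarrow> c \<otimes> (SUP k\<in>I. f k) \<le> d"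
  using SUP_mp_times_leI[of I f c d] by (simp add: mp_times_commute)

text \<open>
  The inequality \<open>v \<ge> A v\<close>, stated entry by entry so that passing to another index set or to a renaming of the
  indices involves no supremum.
\<close>

definition subinvariant_on :: "'i set \<Rightarrow> ('i \<Rightarrow> 'i \<Rightarrow> ereal) \<Rightarrow> ('i \<Rightarrow> ereal) \<Rightarrow> bool" where
  "subinvariant_on I A v \<longleftrightarrow> (\<forall>p\<in>I. \<forall>q\<in>I. A p q \<otimes> v q \<le> v p)"

lemma subinvariant_onD:
  "subinvariant_on I A v \<Longrightarrow> p \<in> I \<Longrightarrow> q \<in> I \<Longrightarrow> A p q \<otimes> v q \<le> v p"
  by (simp add: subinvariant_on_def)

lemma mp_mult_vec_le_iff: "A \<otimes>v v \<le> v \<longleftrightarrow> subinvariant_on UNIV A v"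
  by (auto simp: mp_mult_vec_def subinvariant_on_def le_fun_def SUP_le_iff)

lemma subinvariant_on_mp_pow:
  assumes "subinvariant_on I A v"
  shows "subinvariant_on I (mp_pow_on I A k) v"
proof (induction k)
  case 0
  then show ?case
    by (auto simp: subinvariant_on_def mp_id_def)
next
  case (Suc k)
  show ?case
    unfolding subinvariant_on_def mp_pow_on.simps mp_mult_on_def
  proof (intro ballI SUP_mp_times_leI)
    fix p q s assume I: "p \<in> I" "q \<in> I" "s \<in> I"
    have "(mp_pow_on I A k p s \<otimes> A s q) \<otimes> v q \<le> mp_pow_on I A k p s \<otimes> v s"
      unfolding mp_times_assoc
      by (intro mp_times_mono subinvariant_onD[OF assms]) (use I in auto)
    also have "\<dots> \<le> v p"
      using subinvariant_onD[OF Suc.IH] I by blast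
    finally show "(mp_pow_on I A k p s \<otimes> A s q) \<otimes> v q \<le> v p" .
  qed
qed

lemma subinvariant_on_mp_star:
  assumes "subinvariant_on I A v"
  shows "subinvariant_on I (mp_star_on I A) v"
  unfolding subinvariant_on_def mp_star_on_def
  by (intro ballI SUP_mp_times_leI) (rule subinvariant_onD[OF subinvariant_on_mp_pow[OF assms]])

text \<open>
  Powers are defined by multiplication from the right; this is the multiplication from the left, which makes the
  columns of the star subinvariant.
\<close>

lemma mp_times_mp_pow_le:
  assumes "p \<in> I" "q \<in> I" "r \<in> I"
  shows "A p q \<otimes> mp_pow_on I A k q r \<le> mp_pow_on I A (Suc k) p r"
  using assms
proof (induction k arbitrary: r)
  case 0
  have "mp_id p p \<otimes> A p r \<le> (SUP s\<in>I. mp_id p s \<otimes> A s r)"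
    by (rule SUP_upper) (use 0 in auto)
  then show ?case
    by (auto simp: mp_mult_on_def mp_id_def)
next
  case (Suc k)
  have "A p q \<otimes> (SUP s\<in>I. mp_pow_on I A k q s \<otimes> A s r)
      \<le> (SUP s\<in>I. mp_pow_on I A (Suc k) p s \<otimes> A s r)"
  proof (intro mp_times_SUP_leI)
    fix s assume s: "s \<in> I"
    have "A p q \<otimes> (mp_pow_on I A k q s \<otimes> A s r) \<le> mp_pow_on I A (Suc k) p s \<otimes> A s r"
      unfolding mp_times_assoc[symmetric]
      by (intro mp_times_mono Suc.IH order_refl) (use Suc.prems s in auto)
    also have "\<dots> \<le> (SUP s\<in>I. mp_pow_on I A (Suc k) p s \<otimes> A s r)"
      by (rule SUP_upper) (rule s)
    finally show "A p q \<otimes> (mp_pow_on I A k q s \<otimes> A s r)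
      \<le> (SUP s\<in>I. mp_pow_on I A (Suc k) p s \<otimes> A s r)" .
  qed
  then show ?case
    by (simp add: mp_mult_on_def)
qed

lemma mp_star_trans:
  assumes "p \<in> I" "q \<in> I" "r \<in> I"
  shows "mp_star_on I A p q \<otimes> mp_star_on I A q r \<le> mp_star_on I A p r"
proof -
  have "A p q \<otimes> mp_star_on I A q r \<le> mp_star_on I A p r" if "p \<in> I" "q \<in> I" for p q
    unfolding mp_star_on_def
    by (intro mp_times_SUP_leI order_trans[OF mp_times_mp_pow_le[OF that assms(3)]] SUP_upper) simp
  then have "subinvariant_on I A (\<lambda>p. mp_star_on I A p r)"
    by (simp add: subinvariant_on_def)
  then show ?thesis
    using assms by (blast dest: subinvariant_on_mp_star subinvariant_onD)
qed

lemma mp_star_refl: "0 \<le> mp_star_on I A p p"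
  unfolding mp_star_on_def by (rule SUP_upper2[of 0]) (simp_all add: mp_id_def)

lemma le_mp_star:
  assumes "p \<in> I"
  shows "A p q \<le> mp_star_on I A p q"
proof -
  have "mp_id p p \<otimes> A p q \<le> (SUP s\<in>I. mp_id p s \<otimes> A s q)"
    by (rule SUP_upper) (rule assms)
  then show ?thesis
    unfolding mp_star_on_def
    by (intro SUP_upper2[of 1]) (simp_all add: mp_mult_on_def mp_id_def)
qed

text \<open>
  A path from \<open>p\<close> to \<open>q\<close> in the graph of \<open>A\<close> is mapped by \<open>f\<close> to a path in the graph of \<open>B\<close>, of at least the
  same weight. The map \<open>f\<close> will be an inclusion of index sets, a renaming of indices, or a shift of the blocks.
\<close>

lemma mp_star_mono_map:
  assumes f: "\<And>p. p \<in> J \<Longrightarrow> f p \<in> I"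
    and le: "\<And>p q. p \<in> J \<Longrightarrow> q \<in> J \<Longrightarrow> A p q \<le> B (f p) (f q)"
    and J: "p \<in> J" "q \<in> J"
  shows "mp_star_on J A p q \<le> mp_star_on I B (f p) (f q)"
proof -
  have "mp_pow_on J A k p q \<le> mp_pow_on I B k (f p) (f q)" if "q \<in> J" for k q
    using that
  proof (induction k arbitrary: q)
    case 0
    then show ?case by (simp add: mp_id_def)
  next
    case (Suc k)
    show ?case
      unfolding mp_pow_on.simps mp_mult_on_def
      by (rule SUP_mono) (use Suc f le in \<open>blast intro: mp_times_mono\<close>)
  qed
  then show ?thesis
    unfolding mp_star_on_def using J by (intro SUP_mono) auto
qed

text \<open>
  The hypotheses say \<open>S \<ge> E\<close> and \<open>S \<ge> S S\<close>, which makes \<open>x \<mapsto> S x\<close> a closure operator. Its image is the set of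
  its closed elements. The corner of a Kleene star satisfies these hypotheses, although it need not
  be the Kleene star of the corresponding corner.
\<close>

lemma mp_Im_closed_matrix_iff:
  fixes S :: "'i::finite \<Rightarrow> 'i \<Rightarrow> ereal"
  assumes S: "S \<in> Rmax_mat" and refl: "\<And>p. 0 \<le> S p p"
    and trans: "\<And>p q r. S p q \<otimes> S q r \<le> S p r"
  shows "x \<in> mp_Im S \<longleftrightarrow> x \<in> Rmax_vec \<and> subinvariant_on UNIV S x"
proof
  assume x: "x \<in> mp_Im S"
  then obtain u where u: "x = S \<otimes>v u"
    by (auto simp: mp_Im_def)
  have "S p q \<otimes> (SUP r. S q r \<otimes> u r) \<le> (SUP r. S p r \<otimes> u r)" for p q
  proof (intro mp_times_SUP_leI)
    fix r
    have "S p q \<otimes> (S q r \<otimes> u r) \<le> S p r \<otimes> u r"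
      unfolding mp_times_assoc[symmetric] by (intro mp_times_mono trans order_refl)
    also have "\<dots> \<le> (SUP r. S p r \<otimes> u r)"
      by (rule SUP_upper) simp
    finally show "S p q \<otimes> (S q r \<otimes> u r) \<le> (SUP r. S p r \<otimes> u r)" .
  qed
  then show "x \<in> Rmax_vec \<and> subinvariant_on UNIV S x"
    using x S mp_Im_subset_Rmax_vec_iff[of S]
    by (auto simp: u mp_mult_vec_def subinvariant_on_def)
next
  assume x: "x \<in> Rmax_vec \<and> subinvariant_on UNIV S x"
  have "x \<le> S \<otimes>v x"
  proof (rule le_funI)
    fix p
    have "0 \<otimes> x p \<le> S p p \<otimes> x p"
      by (intro mp_times_mono refl order_refl)
    also have "\<dots> \<le> (S \<otimes>v x) p"
      unfolding mp_mult_vec_def by (rule SUP_upper) simp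
    finally show "x p \<le> (S \<otimes>v x) p"
      by simp
  qed
  moreover have "S \<otimes>v x \<le> x"
    using x by (simp add: mp_mult_vec_le_iff)
  ultimately have "x = S \<otimes>v x"
    by simp
  then show "x \<in> mp_Im S"
    using x by (auto simp: mp_Im_def)
qed

lemma K_set_iff: "x \<in> K_set L C R \<longleftrightarrow> x \<in> Rmax_vec \<and> subinvariant_on UNIV (H_mat L C R) x"
  by (simp add: K_set_def mp_mult_vec_le_iff)

lemma K_set_eq_mp_Im_star:
  fixes L C R :: "'n::finite \<Rightarrow> 'n \<Rightarrow> ereal"
  assumes "mp_star_on UNIV (H_mat L C R) \<in> Rmax_mat"
  shows "K_set L C R = mp_Im (mp_star_on UNIV (H_mat L C R))"
proof -
  let ?H = "H_mat L C R"
  have "subinvariant_on UNIV ?H x \<longleftrightarrow> subinvariant_on UNIV (mp_star_on UNIV ?H) x" for x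
  proof
    assume *: "subinvariant_on UNIV (mp_star_on UNIV ?H) x"
    have "?H p q \<otimes> x q \<le> mp_star_on UNIV ?H p q \<otimes> x q" for p q
      by (intro mp_times_mono le_mp_star) auto
    then show "subinvariant_on UNIV ?H x"
      using * unfolding subinvariant_on_def by (blast intro: order_trans)
  qed (rule subinvariant_on_mp_star)
  moreover have "x \<in> mp_Im (mp_star_on UNIV ?H) \<longleftrightarrow>
      x \<in> Rmax_vec \<and> subinvariant_on UNIV (mp_star_on UNIV ?H) x" for x
    by (rule mp_Im_closed_matrix_iff) (auto intro: assms mp_star_refl mp_star_trans)
  ultimately show ?thesis
    by (auto simp: K_set_iff)
qed


section \<open>Iterates of the map and finite extensions\<close>

abbreviation top_index :: "'n + 'n \<Rightarrow> nat \<times> 'n" where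
  "top_index \<equiv> case_sum (Pair 1) (Pair 2)"

text \<open>
  If the blocks of a stacked vector are the halves of the states of a trajectory, then the windows at
  \<open>1, 2, 3, \<dots>\<close> are these states.
\<close>

definition window :: "(nat \<times> 'n \<Rightarrow> ereal) \<Rightarrow> nat \<Rightarrow> 'n + 'n \<Rightarrow> ereal" where
  "window v a = case_sum (\<lambda>i. v (a, i)) (\<lambda>i. v (a + 1, i))"

lemma window_1: "window v (Suc 0) p = v (top_index p)"
  by (cases p) (simp_all add: window_def numeral_2_eq_2)

lemma A_bar_B_bar_step:
  "sup (A_bar \<otimes>v x) (B_bar \<otimes>v u) = case_sum (\<lambda>i. x (Inr i)) u"
proof
  fix p
  have A: "(SUP j. A_bar (Inl i) j \<otimes> x j) = x (Inr i)" for i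
  proof (rule antisym)
    show "(SUP j. A_bar (Inl i) j \<otimes> x j) \<le> x (Inr i)"
      by (rule SUP_least) (auto simp: A_bar_def block_2x2_def mp_zero_def mp_id_def split: sum.splits)
    show "x (Inr i) \<le> (SUP j. A_bar (Inl i) j \<otimes> x j)"
      by (rule SUP_upper2[of "Inr i"]) (simp_all add: A_bar_def block_2x2_def mp_id_def)
  qed
  have B: "(SUP j. B_bar (Inr i) j \<otimes> u j) = u i" for i
  proof (rule antisym)
    show "(SUP j. B_bar (Inr i) j \<otimes> u j) \<le> u i"
      by (rule SUP_least) (auto simp: B_bar_def mp_id_def)
    show "u i \<le> (SUP j. B_bar (Inr i) j \<otimes> u j)"
      by (rule SUP_upper2[of i]) (simp_all add: B_bar_def mp_id_def)
  qed
  have A': "(SUP j. A_bar (Inr i) j \<otimes> x j) \<le> -\<infinity>" for i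
    by (rule SUP_least) (auto simp: A_bar_def block_2x2_def mp_zero_def split: sum.splits)
  have B': "(SUP j. B_bar (Inl i) j \<otimes> u j) \<le> -\<infinity>" for i
    by (rule SUP_least) (auto simp: B_bar_def mp_zero_def)
  show "sup (A_bar \<otimes>v x) (B_bar \<otimes>v u) p = case_sum (\<lambda>i. x (Inr i)) u p"
    using A A' B B'
    by (cases p) (auto simp: mp_mult_vec_def sup_fun_def sup.absorb1 sup.absorb2)
qed

lemma mem_phi_iff:
  "x \<in> phi A_bar B_bar X \<longleftrightarrow>
     x \<in> X \<and> x \<in> Rmax_vec \<and> (\<exists>u\<in>Rmax_vec. case_sum (\<lambda>i. x (Inr i)) u \<in> X)"
  by (auto simp: phi_def A_bar_B_bar_step)

lemma mem_M_index: "(a, i) \<in> M_index K \<longleftrightarrow> 1 \<le> a \<and> enat a \<le> K"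
  by (simp add: M_index_def)

lemma M_index_mono: "K \<le> K' \<Longrightarrow> M_index K \<subseteq> M_index K'"
  by (auto simp: M_index_def intro: order_trans)

lemma top_index_in_M_index: "2 \<le> K \<Longrightarrow> top_index p \<in> M_index K"
  by (cases p; cases K) (auto simp: mem_M_index numeral_eq_enat one_enat_def)

lemma M_mat_shift: "M_mat L C R (a + c, i) (b + c, j) = M_mat L C R (a, i) (b, j)"
  by (simp add: M_mat_def)

lemma M_mat_top_index: "M_mat L C R (top_index p) (top_index q) = H_mat L C R p q"
  by (cases p; cases q) (simp_all add: M_mat_def H_mat_def block_2x2_def)

text \<open>
  The matrix \<open>H\<close> is the \<open>2 \<times> 2\<close> pattern of blocks of \<open>M\<close> at two consecutive positions, and every block of \<open>M\<close>
  other than those filled with \<open>-\<infinity>\<close> lies in such a pattern.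
\<close>

lemma subinvariant_on_M_iff:
  assumes K: "2 \<le> K" and v: "v \<in> Rmax_vec"
  shows "subinvariant_on (M_index K) (M_mat L C R) v \<longleftrightarrow>
    (\<forall>a\<ge>1. enat (a + 1) \<le> K \<longrightarrow> window v a \<in> K_set L C R)"
proof
  assume inv: "subinvariant_on (M_index K) (M_mat L C R) v"
  show "\<forall>a\<ge>1. enat (a + 1) \<le> K \<longrightarrow> window v a \<in> K_set L C R"
  proof (intro allI impI)
    fix a :: nat assume a: "1 \<le> a" "enat (a + 1) \<le> K"
    then have a': "enat a \<le> K"
      using order_trans[of "enat a" "enat (a + 1)" K] by simp
    have "H_mat L C R p q \<otimes> window v a q \<le> window v a p" for p q
      using subinvariant_onD[OF inv, of "(a + (case p of Inl _ \<Rightarrow> 0 | Inr _ \<Rightarrow> 1), case_sum id id p)"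
          "(a + (case q of Inl _ \<Rightarrow> 0 | Inr _ \<Rightarrow> 1), case_sum id id q)"] a a'
      by (cases p; cases q)
         (auto simp: mem_M_index window_def H_mat_def block_2x2_def M_mat_def)
    moreover have "window v a \<in> Rmax_vec"
      using v by (auto simp: Rmax_vec_def window_def split: sum.splits)
    ultimately show "window v a \<in> K_set L C R"
      by (simp add: K_set_iff subinvariant_on_def)
  qed
next
  assume win: "\<forall>a\<ge>1. enat (a + 1) \<le> K \<longrightarrow> window v a \<in> K_set L C R"
  have W: "H_mat L C R p q \<otimes> window v a q \<le> window v a p"
    if "1 \<le> a" "enat (a + 1) \<le> K" for a p q
    using win that by (auto simp: K_set_iff subinvariant_on_def)
  show "subinvariant_on (M_index K) (M_mat L C R) v"
    unfolding subinvariant_on_def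
  proof (clarify)
    fix a b :: nat and i j :: 'a
    assume "(a, i) \<in> M_index K" "(b, j) \<in> M_index K"
    then have ab: "1 \<le> a" "enat a \<le> K" "1 \<le> b" "enat b \<le> K"
      by (auto simp: mem_M_index)
    have "b = a \<or> b = a + 1 \<or> a = b + 1 \<or> M_mat L C R (a, i) (b, j) = -\<infinity>"
      by (simp add: M_mat_def)
    then consider "b = a" | "b = a + 1" | "a = b + 1" | "M_mat L C R (a, i) (b, j) = -\<infinity>"
      by blast
    then show "M_mat L C R (a, i) (b, j) \<otimes> v (b, j) \<le> v (a, i)"
    proof cases
      case 1
      \<comment> \<open>A diagonal block is seen by two windows, except that block 1 has only the window that starts with it
        and the last block only the window that ends with it.\<close>
      show ?thesis
      proof (cases "a = 1")
        case True
        then have "enat (a + 1) \<le> K"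
          using K by (simp add: numeral_eq_enat numeral_2_eq_2)
        then show ?thesis
          using W[of a "Inl i" "Inl j"] ab 1
          by (simp add: window_def H_mat_def block_2x2_def M_mat_def)
      next
        case False
        then show ?thesis
          using W[of "a - 1" "Inr i" "Inr j"] ab 1
          by (simp add: window_def H_mat_def block_2x2_def M_mat_def)
      qed
    next
      case 2
      then show ?thesis
        using W[of a "Inl i" "Inr j"] ab
        by (simp add: window_def H_mat_def block_2x2_def M_mat_def)
    next
      case 3
      then show ?thesis
        using W[of b "Inr i" "Inl j"] ab
        by (simp add: window_def H_mat_def block_2x2_def M_mat_def)
    qed simp
  qed
qed

text \<open>
  The states \<open>(x\<^sub>1, x\<^sub>2)\<close> that can be prolonged by vectors \<open>x\<^sub>3, \<dots>, x\<^sub>K\<close> over \<open>\<real>\<^sub>m\<^sub>a\<^sub>x\<close> such that every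
  window up to block \<open>K\<close> satisfies the constraint.
\<close>

definition extensible :: "('n \<Rightarrow> 'n \<Rightarrow> ereal) \<Rightarrow> ('n \<Rightarrow> 'n \<Rightarrow> ereal) \<Rightarrow> ('n \<Rightarrow> 'n \<Rightarrow> ereal)
    \<Rightarrow> enat \<Rightarrow> ('n + 'n \<Rightarrow> ereal) set" where
  "extensible L C R K =
     {window v 1 | v. v \<in> Rmax_vec \<and> subinvariant_on (M_index K) (M_mat L C R) v}"

text \<open>
  A state in \<open>\<phi>\<^sup>k\<^sup>+\<^sup>1(\<K>)\<close> lies in \<open>\<K>\<close> and has a successor in \<open>\<phi>\<^sup>k(\<K>)\<close>; putting its first half in front of the
  solution for the successor gives a solution with one more block. Conversely, deleting the first block
  of a solution leaves one for the successor, and deleting the last block leaves a shorter one for the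
  state itself.
\<close>

lemma phi_power_eq_extensible:
  "(phi A_bar B_bar ^^ k) (K_set L C R) = extensible L C R (enat (k + 2))"
proof (induction k)
  case 0
  have "x \<in> extensible L C R (enat 2)" if x: "x \<in> K_set L C R" for x
  proof -
    define v where "v = (\<lambda>(a::nat, i). if a = 1 then x (Inl i) else x (Inr i))"
    have w: "window v 1 = x"
      by (rule ext) (simp add: v_def window_def split: sum.splits)
    have v: "v \<in> Rmax_vec"
      using x by (auto simp: K_set_iff Rmax_vec_def v_def)
    have "window v a \<in> K_set L C R" if "1 \<le> a" "a + 1 \<le> 2" for a
    proof -
      have "a = 1"
        using that by simp
      then show ?thesis
        using w x by simp
    qed
    then have "subinvariant_on (M_index (enat 2)) (M_mat L C R) v"
      using v by (subst subinvariant_on_M_iff) (auto simp: numeral_eq_enat)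
    then show ?thesis
      unfolding extensible_def using v w by blast
  qed
  moreover have "extensible L C R (enat 2) \<subseteq> K_set L C R"
    by (auto simp: extensible_def subinvariant_on_M_iff numeral_eq_enat)
  ultimately show ?case
    by (auto simp: numeral_2_eq_2)
next
  case (Suc k)
  have two: "(2::enat) \<le> enat (k + 2)" "(2::enat) \<le> enat (Suc k + 2)"
    by (simp_all add: numeral_eq_enat)
  show ?case
  proof (rule set_eqI, rule iffI)
    fix x assume "x \<in> (phi A_bar B_bar ^^ Suc k) (K_set L C R)"
    then obtain u where x: "x \<in> extensible L C R (enat (k + 2))" "x \<in> Rmax_vec"
      and u: "case_sum (\<lambda>i. x (Inr i)) u \<in> extensible L C R (enat (k + 2))"
      by (auto simp: Suc.IH mem_phi_iff)
    have xK: "x \<in> K_set L C R"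
      using x(1) two(1) by (auto simp: extensible_def subinvariant_on_M_iff)
    obtain v where v: "window v 1 = case_sum (\<lambda>i. x (Inr i)) u" "v \<in> Rmax_vec"
      and inv: "subinvariant_on (M_index (enat (k + 2))) (M_mat L C R) v"
      using u by (auto simp: extensible_def)
    define w where "w = (\<lambda>(a::nat, i). if a \<le> 1 then x (Inl i) else v (a - 1, i))"
    have w: "w \<in> Rmax_vec"
      using x v by (auto simp: Rmax_vec_def w_def)
    have v1: "v (Suc 0, i) = x (Inr i)" for i
      using fun_cong[OF v(1), of "Inl i"] by (simp add: window_def)
    have w1: "window w 1 = x"
      by (rule ext) (simp add: w_def v1 window_def split: sum.splits)
    have wa: "window w a = window v (a - 1)" if "2 \<le> a" for a
      using that by (intro ext) (simp add: w_def window_def split: sum.splits)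
    have "window w a \<in> K_set L C R" if "1 \<le> a" "a + 1 \<le> Suc k + 2" for a
    proof (cases "a = 1")
      case True
      then show ?thesis
        using w1 xK by simp
    next
      case False
      then have "window v (a - 1) \<in> K_set L C R"
        using inv that v two by (simp add: subinvariant_on_M_iff)
      then show ?thesis
        using False that wa by simp
    qed
    then have "subinvariant_on (M_index (enat (Suc k + 2))) (M_mat L C R) w"
      using w two by (subst subinvariant_on_M_iff) auto
    then show "x \<in> extensible L C R (enat (Suc k + 2))"
      unfolding extensible_def using w w1 by blast
  next
    fix x assume "x \<in> extensible L C R (enat (Suc k + 2))"
    then obtain v where v: "window v 1 = x" "v \<in> Rmax_vec"
      and inv: "subinvariant_on (M_index (enat (Suc k + 2))) (M_mat L C R) v"
      by (auto simp: extensible_def)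
    have win: "window v a \<in> K_set L C R" if "1 \<le> a" "a + 1 \<le> Suc k + 2" for a
      using inv that v two by (simp add: subinvariant_on_M_iff)
    define w where "w = (\<lambda>(a::nat, i). v (a + 1, i))"
    have w: "w \<in> Rmax_vec"
      using v by (auto simp: Rmax_vec_def w_def)
    have wa: "window w a = window v (a + 1)" for a
      by (intro ext) (simp add: w_def window_def split: sum.splits)
    have "subinvariant_on (M_index (enat (k + 2))) (M_mat L C R) v"
      using v two win by (simp add: subinvariant_on_M_iff)
    then have 1: "x \<in> extensible L C R (enat (k + 2))"
      unfolding extensible_def using v by blast
    have "subinvariant_on (M_index (enat (k + 2))) (M_mat L C R) w"
      using w two win by (simp add: subinvariant_on_M_iff wa)
    then have 2: "window w 1 \<in> extensible L C R (enat (k + 2))"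
      unfolding extensible_def using w by blast
    have 3: "window w 1 = case_sum (\<lambda>i. x (Inr i)) (\<lambda>i. v (3, i))"
      unfolding v(1)[symmetric]
      by (rule ext) (simp add: w_def window_def numeral_3_eq_3 split: sum.splits)
    have 4: "x \<in> Rmax_vec"
      using v by (auto simp: Rmax_vec_def window_def split: sum.splits)
    have "(\<lambda>i. v (3, i)) \<in> Rmax_vec"
      using v by (auto simp: Rmax_vec_def)
    then show "x \<in> (phi A_bar B_bar ^^ Suc k) (K_set L C R)"
      using 1 2 3 4 by (auto simp: Suc.IH mem_phi_iff)
  qed
qed

section \<open>Images of the top-left blocks\<close>

lemma S_mat_eq:
  "S_mat L C R K p q = mp_star_on (M_index K) (M_mat L C R) (top_index p) (top_index q)"
  by (simp add: S_mat_def top_left_def)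

lemma S_mat_mono:
  assumes "2 \<le> K" "K \<le> K'"
  shows "S_mat L C R K p q \<le> S_mat L C R K' p q"
  unfolding S_mat_eq
  by (rule mp_star_mono_map[where f = "\<lambda>p. p"])
     (use M_index_mono[OF assms(2)] top_index_in_M_index[OF assms(1)] in auto)

lemma S_mat_Rmax_antimono:
  assumes "2 \<le> K" "K \<le> K'" "S_mat L C R K' \<in> Rmax_mat"
  shows "S_mat L C R K \<in> Rmax_mat"
  unfolding Rmax_mat_def Rmax_def mem_Collect_eq
proof (intro allI)
  fix p q
  show "S_mat L C R K p q \<noteq> \<infinity>"
    using S_mat_mono[OF assms(1,2), of L C R p q] assms(3) by (auto simp: Rmax_mat_def Rmax_def)
qed

lemma S_mat_2: "S_mat L C R 2 = mp_star_on UNIV (H_mat L C R)"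
proof (intro ext antisym)
  fix p q :: "'a + 'a"
  define f :: "nat \<times> 'a \<Rightarrow> 'a + 'a" where "f = (\<lambda>(a, i). if a = 1 then Inl i else Inr i)"
  have f: "f (top_index p) = p" for p
    by (cases p) (simp_all add: f_def)
  have g: "top_index (f p) = p" if "p \<in> M_index 2" for p
    using that
    by (cases p) (auto simp: f_def mem_M_index numeral_eq_enat)
  show "S_mat L C R 2 p q \<le> mp_star_on UNIV (H_mat L C R) p q"
  proof -
    have "M_mat L C R p q \<le> H_mat L C R (f p) (f q)" if "p \<in> M_index 2" "q \<in> M_index 2" for p q
      using M_mat_top_index[of L C R "f p" "f q"] unfolding g[OF that(1)] g[OF that(2)] by simp
    then have "mp_star_on (M_index 2) (M_mat L C R) (top_index p) (top_index q)
        \<le> mp_star_on UNIV (H_mat L C R) (f (top_index p)) (f (top_index q))"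
      by (intro mp_star_mono_map top_index_in_M_index) auto
    then show ?thesis
      unfolding f S_mat_eq .
  qed
  show "mp_star_on UNIV (H_mat L C R) p q \<le> S_mat L C R 2 p q"
    unfolding S_mat_eq
    by (intro mp_star_mono_map top_index_in_M_index eq_refl M_mat_top_index[symmetric]) auto
qed

text \<open>
  With one block more, blocks \<open>2, \<dots>, K + 1\<close> carry a copy of the matrix with \<open>K\<close> blocks. So the weights of paths
  from block \<open>1\<close> to itself reappear from block \<open>2\<close> to itself.
\<close>

lemma S_mat_Inl_le_Inr:
  assumes "2 \<le> K"
  shows "S_mat L C R (enat K) (Inl i) (Inl j) \<le> S_mat L C R (enat (K + 1)) (Inr i) (Inr j)"
proof -
  let ?f = "\<lambda>p :: nat \<times> 'a. (fst p + 1, snd p)"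
  have "M_mat L C R (?f p) (?f q) = M_mat L C R p q" for p q
    using M_mat_shift[of L C R "fst p" 1 "snd p" "fst q" "snd q"] by simp
  then have "mp_star_on (M_index (enat K)) (M_mat L C R) (1, i) (1, j)
      \<le> mp_star_on (M_index (enat (K + 1))) (M_mat L C R) (?f (1, i)) (?f (1, j))"
    using assms by (intro mp_star_mono_map) (auto simp: mem_M_index)
  then show ?thesis
    by (simp add: S_mat_eq numeral_2_eq_2)
qed

lemma mem_mp_Im_S_mat_iff:
  fixes L C R :: "'n::finite \<Rightarrow> 'n \<Rightarrow> ereal"
  assumes "S_mat L C R K \<in> Rmax_mat" "2 \<le> K"
  shows "x \<in> mp_Im (S_mat L C R K) \<longleftrightarrow> x \<in> Rmax_vec \<and> subinvariant_on UNIV (S_mat L C R K) x"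
  using assms
  by (intro mp_Im_closed_matrix_iff)
     (auto simp: S_mat_eq top_index_in_M_index intro: mp_star_refl mp_star_trans)

lemma mp_Im_S_mat_antimono:
  fixes L C R :: "'n::finite \<Rightarrow> 'n \<Rightarrow> ereal"
  assumes "S_mat L C R K' \<in> Rmax_mat" "2 \<le> K" "K \<le> K'"
  shows "mp_Im (S_mat L C R K') \<subseteq> mp_Im (S_mat L C R K)"
proof -
  have "subinvariant_on UNIV (S_mat L C R K) x" if "subinvariant_on UNIV (S_mat L C R K') x" for x
  proof -
    have "S_mat L C R K p q \<otimes> x q \<le> S_mat L C R K' p q \<otimes> x q" for p q
      by (intro mp_times_mono S_mat_mono assms order_refl)
    then show ?thesis
      using that unfolding subinvariant_on_def by (blast intro: order_trans)
  qed
  then show ?thesis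
    using assms S_mat_Rmax_antimono[OF assms(2,3,1)] order_trans[OF assms(2,3)]
    by (auto simp: mem_mp_Im_S_mat_iff)
qed

lemma extensible_subset_mp_Im_S_mat:
  fixes L C R :: "'n::finite \<Rightarrow> 'n \<Rightarrow> ereal"
  assumes "S_mat L C R K \<in> Rmax_mat" "2 \<le> K"
  shows "extensible L C R K \<subseteq> mp_Im (S_mat L C R K)"
proof
  fix x assume "x \<in> extensible L C R K"
  then obtain v where v: "x = window v 1" "v \<in> Rmax_vec"
    and inv: "subinvariant_on (M_index K) (M_mat L C R) v"
    by (auto simp: extensible_def)
  have "S_mat L C R K p q \<otimes> x q \<le> x p" for p q
    using subinvariant_onD[OF subinvariant_on_mp_star[OF inv]] assms(2)
    by (simp add: S_mat_eq v(1) window_1 top_index_in_M_index)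
  moreover have "x \<in> Rmax_vec"
    using v by (auto simp: Rmax_vec_def window_def split: sum.splits)
  ultimately show "x \<in> mp_Im (S_mat L C R K)"
    by (simp add: mem_mp_Im_S_mat_iff[OF assms] subinvariant_on_def)
qed

text \<open>
  In the induction step \<open>S\<close> and \<open>T\<close> are the corners for \<open>k + 2\<close> and \<open>k + 3\<close> blocks, and \<open>x = (x\<^sub>1, x\<^sub>2)\<close> satisfies
  \<open>x \<ge> T x\<close>. Since \<open>T \<ge> S\<close>, also \<open>x \<in> Im S\<close>. It remains to find \<open>u\<close> with \<open>(x\<^sub>2, u) \<in> Im S\<close>. The vector
  \<open>y = S (x\<^sub>2, -\<infinity>)\<close> has no entry \<open>\<infinity>\<close>, because \<open>S\<close> has none, and its first half equals \<open>x\<^sub>2\<close>: it is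
  at least \<open>x\<^sub>2\<close> by \<open>S \<ge> E\<close>, and at most \<open>x\<^sub>2\<close> because the upper left block of \<open>S\<close> is, by translation, below the
  lower right block of \<open>T\<close>. So the second half of \<open>y\<close> serves as \<open>u\<close>.
\<close>

lemma mp_Im_S_mat_subset_phi_power:
  fixes L C R :: "'n::finite \<Rightarrow> 'n \<Rightarrow> ereal"
  assumes "S_mat L C R (enat (k + 2)) \<in> Rmax_mat"
  shows "mp_Im (S_mat L C R (enat (k + 2))) \<subseteq> (phi A_bar B_bar ^^ k) (K_set L C R)"
  using assms
proof (induction k)
  case 0
  have "S_mat L C R (enat (0 + 2)) = mp_star_on UNIV (H_mat L C R)"
    using S_mat_2[of L C R] by (simp add: numeral_eq_enat numeral_2_eq_2)
  then show ?case
    using 0 K_set_eq_mp_Im_star[of L C R] by simp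
next
  case (Suc k)
  let ?S = "S_mat L C R (enat (k + 2))" and ?T = "S_mat L C R (enat (k + 2 + 1))"
  have two: "(2::enat) \<le> enat (k + 2)" "(2::enat) \<le> enat (k + 2 + 1)"
    "enat (k + 2) \<le> enat (k + 2 + 1)"
    by (simp_all add: numeral_eq_enat)
  have T: "?T \<in> Rmax_mat"
    using Suc.prems by simp
  have S: "?S \<in> Rmax_mat"
    using S_mat_Rmax_antimono[OF two(1,3) T] .
  show ?case
  proof
    fix x assume "x \<in> mp_Im (S_mat L C R (enat (Suc k + 2)))"
    then have xT: "x \<in> mp_Im ?T"
      by simp
    then have x: "x \<in> Rmax_vec" and inv: "subinvariant_on UNIV ?T x"
      unfolding mem_mp_Im_S_mat_iff[OF T two(2)] by blast+
    have xS: "x \<in> mp_Im ?S"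
      using mp_Im_S_mat_antimono[OF T two(1,3)] xT by blast
    define u where "u = case_sum (\<lambda>i. x (Inr i)) (\<lambda>_::'n. -\<infinity>)"
    have u: "u \<in> Rmax_vec"
      using x by (auto simp: u_def Rmax_vec_def Rmax_def split: sum.splits)
    define y where "y = ?S \<otimes>v u"
    have yIm: "y \<in> mp_Im ?S"
      unfolding y_def mp_Im_def using u by blast
    then have y: "y \<in> Rmax_vec"
      using mem_mp_Im_S_mat_iff[OF S two(1)] by blast
    have "y (Inl i) = x (Inr i)" for i
    proof (rule antisym)
      have "?S (Inl i) q \<otimes> u q \<le> x (Inr i)" for q
      proof (cases q)
        case (Inl j)
        have "?S (Inl i) q \<otimes> u q \<le> ?T (Inr i) (Inr j) \<otimes> x (Inr j)"
          using mp_times_mono[OF S_mat_Inl_le_Inr[of "k + 2" L C R i j] order_refl[of "x (Inr j)"]]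
          by (simp add: Inl u_def)
        also have "\<dots> \<le> x (Inr i)"
          by (rule subinvariant_onD[OF inv]) auto
        finally show ?thesis .
      qed (simp add: u_def)
      then show "y (Inl i) \<le> x (Inr i)"
        unfolding y_def mp_mult_vec_def by (intro SUP_least) auto
      have "0 \<otimes> u (Inl i) \<le> ?S (Inl i) (Inl i) \<otimes> u (Inl i)"
        by (intro mp_times_mono order_refl) (simp add: S_mat_eq mp_star_refl)
      also have "\<dots> \<le> y (Inl i)"
        unfolding y_def mp_mult_vec_def by (rule SUP_upper) simp
      finally show "x (Inr i) \<le> y (Inl i)"
        by (simp add: u_def)
    qed
    then have "case_sum (\<lambda>i. x (Inr i)) (\<lambda>i. y (Inr i)) = y"
      by (intro ext) (simp split: sum.splits)
    moreover have "(\<lambda>i. y (Inr i)) \<in> Rmax_vec"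
      using y by (simp add: Rmax_vec_def)
    ultimately have "\<exists>u\<in>Rmax_vec. case_sum (\<lambda>i. x (Inr i)) u \<in> mp_Im ?S"
      using yIm by (intro bexI[of _ "\<lambda>i. y (Inr i)"]) simp_all
    then show "x \<in> (phi A_bar B_bar ^^ Suc k) (K_set L C R)"
      using Suc.IH[OF S] xS x unfolding funpow.simps comp_def mem_phi_iff by blast
  qed
qed

section \<open>Infinite extensions\<close>

text \<open>
  A limit \<open>-\<infinity>\<close> is below everything. If the limit is real, then \<open>f\<close> is eventually real and its distance to the
  limit is bounded, hence eventually below \<open>t\<close>. Taking the same \<open>t\<close> for the index and for the additive
  constant lets finitely many such statements be combined as eventualities.
\<close>

lemma eventually_SUP_le_add:
  fixes f :: "nat \<Rightarrow> ereal"
  assumes mono: "incseq f" and fin: "(SUP k. f k) \<noteq> \<infinity>"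
  shows "\<forall>\<^sub>F t in sequentially. (SUP k. f k) \<le> ereal (real t) \<otimes> f t"
proof (cases "\<exists>k. f k \<noteq> -\<infinity>")
  case False
  then have "(SUP k. f k) = -\<infinity>"
    by simp
  then show ?thesis
    by simp
next
  case True
  then obtain k where k: "f k \<noteq> -\<infinity>"
    by blast
  have le: "f k \<le> (SUP k. f k)"
    by (rule SUP_upper) simp
  obtain r where r: "f k = ereal r"
    using k le fin by (cases "f k") auto
  obtain s where s: "(SUP k. f k) = ereal s"
    using le fin r by (cases "SUP k. f k") auto
  have "(SUP k. f k) \<le> ereal (real t) \<otimes> f t" if t: "max k (nat \<lceil>s - r\<rceil>) \<le> t" for t
  proof -
    have "s \<le> real t + r"
      using t by linarith
    then have "(SUP k. f k) \<le> ereal (real t) \<otimes> f k"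
      by (simp add: r s mp_times_def)
    also have "\<dots> \<le> ereal (real t) \<otimes> f t"
      by (intro mp_times_mono order_refl incseqD[OF mono]) (use t in simp)
    finally show ?thesis .
  qed
  then show ?thesis
    unfolding eventually_sequentially by blast
qed

text \<open>
  Let \<open>v k\<close> be the least extension of \<open>x\<close> satisfying the constraints on \<open>k + 2\<close> blocks, and \<open>V\<close> the supremum of the
  increasing sequence \<open>v\<close>. Then \<open>V \<ge> M V\<close>, and everything comes down to showing that \<open>V\<close> does not take the value \<open>\<infinity>\<close>.

  Call a node, that is a block number and an index in the block, infinite if \<open>V\<close> has the value \<open>\<infinity>\<close> there;
  the edges are the entries of \<open>M\<close> other than \<open>-\<infinity>\<close>. By
  \<open>V \<ge> M V\<close>, a node with an edge to an infinite node is infinite. Nodes in blocks \<open>1\<close> and \<open>2\<close> are not infinite.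
  Let \<open>F\<close> be the set of the indices \<open>j\<close> for which some node \<open>(l, j)\<close> is infinite, and \<open>d j \<ge> 3\<close> the least such \<open>l\<close>.
  If there is an edge from \<open>(l, i)\<close> to \<open>(b, j)\<close> with \<open>j \<in> F\<close>, then its translate that ends at \<open>(d j, j)\<close>
  starts at an infinite node, whence \<open>i \<in> F\<close> and \<open>d i - l \<le> d j - b\<close>: along an edge within \<open>F\<close>,
  the block number minus \<open>d\<close> does not increase. So an edge that leaves the finite set \<open>D\<close> of nodes \<open>(m, j)\<close> with \<open>j \<in> F\<close>
  and \<open>m \<le> d j\<close> ends at an index outside \<open>F\<close>, in a finite set \<open>B\<close> of nodes that are not infinite.

  Choose \<open>t\<close> so large that \<open>V \<le> t + v t\<close> on \<open>B\<close>. Then \<open>w = t + v t\<close> is above \<open>V\<close> at the exits of \<open>D\<close>, so that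
  replacing \<open>v k\<close> by \<open>min (v k) w\<close> on \<open>D\<close> yields another extension; the first two blocks keep their values
  because \<open>w \<ge> v t\<close>. By minimality of \<open>v k\<close> it follows that \<open>v k \<le> w\<close> on \<open>D\<close> for all \<open>k\<close>, so no node of \<open>D\<close> is
  infinite. But an element \<open>j\<close> of \<open>F\<close> would give the infinite node \<open>(d j, j)\<close> of \<open>D\<close>, so \<open>F\<close> is empty.
\<close>

lemma extensible_infinity:
  fixes L C R :: "'n::finite \<Rightarrow> 'n \<Rightarrow> ereal"
  assumes x: "\<And>k. x \<in> extensible L C R (enat (k + 2))"
  shows "x \<in> extensible L C R \<infinity>"
proof -
  let ?M = "M_mat L C R" and ?I = "\<lambda>k. M_index (enat (k + 2)) :: (nat \<times> 'n) set"
  define Ext where "Ext k = {y. subinvariant_on (?I k) ?M y \<and> window y 1 = x}" for k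
  define v where "v k p = (INF y\<in>Ext k. y p)" for k p
  define V where "V p = (SUP k. v k p)" for p
  have I_mono: "?I k \<subseteq> ?I k'" if "k \<le> k'" for k k'
    using that by (intro M_index_mono) simp
  have v_le: "v k p \<le> y p" if "y \<in> Ext k" for y k p
    unfolding v_def using that by (rule INF_lower)
  have Ext_Rmax: "\<exists>y\<in>Ext k. y \<in> Rmax_vec" for k
    using x[of k] by (auto simp: extensible_def Ext_def)
  have v_Rmax: "v k p \<noteq> \<infinity>" for k p
  proof -
    obtain y where "y \<in> Ext k" "y p \<noteq> \<infinity>"
      using Ext_Rmax[of k] unfolding Rmax_vec_def Rmax_def by blast
    then show ?thesis
      using v_le[of y k p] by auto
  qed
  have v_inv: "subinvariant_on (?I k) ?M (v k)" for k
    unfolding subinvariant_on_def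
  proof (intro ballI)
    fix p q assume pq: "p \<in> ?I k" "q \<in> ?I k"
    show "?M p q \<otimes> v k q \<le> v k p"
      unfolding v_def[of k p]
    proof (rule INF_greatest)
      fix y assume y: "y \<in> Ext k"
      have "?M p q \<otimes> v k q \<le> ?M p q \<otimes> y q"
        by (intro mp_times_mono v_le y order_refl)
      also have "\<dots> \<le> y p"
        using y pq by (auto simp: Ext_def dest: subinvariant_onD)
      finally show "?M p q \<otimes> v k q \<le> y p" .
    qed
  qed
  have v_top: "v k (top_index p) = x p" for k p
  proof -
    have "y (top_index p) = x p" if "y \<in> Ext k" for y
      using that by (auto simp: Ext_def window_1)
    then show ?thesis
      unfolding v_def using Ext_Rmax[of k] by (intro INF_eq_const) auto
  qed
  have v_mono: "incseq (\<lambda>k. v k p)" for p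
  proof (rule incseq_SucI)
    fix k
    have "Ext (Suc k) \<subseteq> Ext k"
      using I_mono[of k "Suc k"] by (auto simp: Ext_def subinvariant_on_def)
    then show "v k p \<le> v (Suc k) p"
      unfolding v_def by (rule INF_superset_mono) simp
  qed
  have V_upper: "v k p \<le> V p" for k p
    unfolding V_def by (rule SUP_upper) simp
  have V_top: "V (top_index p) = x p" for p
    by (simp add: V_def v_top)
  have x_Rmax: "x p \<noteq> \<infinity>" for p
    using v_Rmax[of 0 "top_index p"] v_top by simp
  have V_inv: "?M p q \<otimes> V q \<le> V p" if pq: "fst p \<ge> 1" "fst q \<ge> 1" for p q
    unfolding V_def[of q]
  proof (rule mp_times_SUP_leI)
    fix k
    let ?k = "max k (max (fst p) (fst q))"
    have "p \<in> ?I ?k" "q \<in> ?I ?k"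
      using pq by (cases p; cases q; simp add: mem_M_index)+
    have "?M p q \<otimes> v k q \<le> ?M p q \<otimes> v ?k q"
      by (intro mp_times_mono order_refl incseqD[OF v_mono]) simp
    also have "\<dots> \<le> v ?k p"
      by (rule subinvariant_onD[OF v_inv]) fact+
    also have "\<dots> \<le> V p"
      by (rule V_upper)
    finally show "?M p q \<otimes> v k q \<le> V p" .
  qed
  have V_fin: "V (a, i) \<noteq> \<infinity>" if "1 \<le> a" for a i
  proof
    assume inf: "V (a, i) = \<infinity>"
    define F where "F = {j. \<exists>l\<ge>1. V (l, j) = \<infinity>}"
    define d where "d j = (LEAST l. 1 \<le> l \<and> V (l, j) = \<infinity>)" for j
    have d: "1 \<le> d j" "V (d j, j) = \<infinity>" if "j \<in> F" for j
      using that LeastI_ex[of "\<lambda>l. 1 \<le> l \<and> V (l, j) = \<infinity>"] by (auto simp: F_def d_def)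
    have d_least: "d j \<le> l" if "1 \<le> l" "V (l, j) = \<infinity>" for l j
      unfolding d_def using that by (simp add: Least_le)
    have d3: "3 \<le> d j" if "j \<in> F" for j
    proof -
      have "d j \<noteq> 1" "d j \<noteq> 2"
        using d(2)[OF that] V_top[of "Inl j"] V_top[of "Inr j"] x_Rmax by auto
      then show ?thesis
        using d(1)[OF that] by linarith
    qed
    have d_edge: "d i + b \<le> d j + l"
      if "j \<in> F" "1 \<le> l" "1 \<le> b" and M: "?M (l, i) (b, j) \<noteq> -\<infinity>" for l b i j
    proof -
      have lb: "b \<le> l + 1" "l \<le> b + 1"
        using M by (auto simp: M_mat_def split: if_splits)
      \<comment> \<open>\<open>m\<close> is the block where the edge starts once it is translated to end at \<open>(d j, j)\<close>.\<close>
      define m where "m = d j + l - b"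
      have m: "m + b = d j + l" "2 \<le> m"
        using d3[OF \<open>j \<in> F\<close>] lb by (auto simp: m_def)
      have "?M (m, i) (d j, j) = ?M (m + b, i) (d j + b, j)"
        by (rule M_mat_shift[symmetric])
      also have "\<dots> = ?M (l + d j, i) (b + d j, j)"
        by (simp add: m(1) add.commute[of l] add.commute[of b])
      also have "\<dots> = ?M (l, i) (b, j)"
        by (rule M_mat_shift)
      finally have "?M (m, i) (d j, j) \<otimes> V (d j, j) = \<infinity>"
        using M d[OF \<open>j \<in> F\<close>] by (simp add: mp_times_PInfty)
      then have "V (m, i) = \<infinity>"
        using V_inv[of "(m, i)" "(d j, j)"] m d[OF \<open>j \<in> F\<close>] by simp
      then show ?thesis
        using d_least[of m i] m by simp
    qed
    define D where "D = {(m, j). j \<in> F \<and> 1 \<le> m \<and> m \<le> d j}"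
    \<comment> \<open>An edge from a node of \<open>D\<close> leads at most one block further, hence into the first \<open>N\<close> blocks.\<close>
    define N where "N = Suc (Max (range d))"
    have dN: "d j < N" for j
      by (simp add: N_def less_Suc_eq_le)
    define B where "B = {1..N} \<times> (- F)"
    have "\<forall>q\<in>B. \<forall>\<^sub>F t in sequentially. V q \<le> ereal (real t) \<otimes> v t q"
    proof
      fix q assume "q \<in> B"
      then have "V q \<noteq> \<infinity>"
        by (auto simp: B_def F_def)
      then show "\<forall>\<^sub>F t in sequentially. V q \<le> ereal (real t) \<otimes> v t q"
        unfolding V_def by (intro eventually_SUP_le_add v_mono)
    qed
    moreover have "finite B"
      by (simp add: B_def)
    ultimately have "\<forall>\<^sub>F t in sequentially. \<forall>q\<in>B. V q \<le> ereal (real t) \<otimes> v t q"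
      by (simp add: eventually_ball_finite)
    then have "\<forall>\<^sub>F t in sequentially. (\<forall>q\<in>B. V q \<le> ereal (real t) \<otimes> v t q) \<and> N \<le> t"
      by (intro eventually_conj eventually_ge_at_top)
    then obtain t where t: "\<And>q. q \<in> B \<Longrightarrow> V q \<le> ereal (real t) \<otimes> v t q" and Nt: "N \<le> t"
      using eventually_happens'[OF sequentially_bot] by blast
    define w where "w p = ereal (real t) \<otimes> v t p" for p
    have w_inv: "?M p q \<otimes> w q \<le> w p" if "p \<in> ?I t" "q \<in> ?I t" for p q
    proof -
      have "?M p q \<otimes> w q = ereal (real t) \<otimes> (?M p q \<otimes> v t q)"
        unfolding w_def by (metis mp_times_assoc mp_times_commute)
      also have "\<dots> \<le> w p"
        unfolding w_def by (intro mp_times_mono order_refl subinvariant_onD[OF v_inv] that)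
      finally show ?thesis .
    qed
    have v_le_w: "v t p \<le> w p" for p
      using mp_times_mono[of 0 "ereal (real t)" "v t p" "v t p"] by (simp add: w_def)
    have bounded: "v k p \<le> w p" if p: "p \<in> D" for k p
    proof -
      define y where "y = (\<lambda>p. if p \<in> D then min (v k p) (w p) else v k p)"
      have y_le: "y q \<le> v k q" for q
        by (simp add: y_def)
      have "?M p q \<otimes> y q \<le> y p" if pq: "p \<in> ?I k" "q \<in> ?I k" for p q
      proof -
        have 1: "?M p q \<otimes> y q \<le> v k p"
          using mp_times_mono[OF order_refl y_le] subinvariant_onD[OF v_inv pq]
          by (rule order_trans)
        have 2: "?M p q \<otimes> y q \<le> w p" if "p \<in> D"
        proof (cases "?M p q = -\<infinity>")
          case False
          obtain l i b j where p_eq: "p = (l, i)" and q_eq: "q = (b, j)"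
            by (cases p; cases q)
          have l: "i \<in> F" "1 \<le> l" "l \<le> d i" and b: "1 \<le> b"
            using \<open>p \<in> D\<close> pq by (auto simp: D_def p_eq q_eq mem_M_index)
          have near: "b \<le> l + 1"
            using False by (auto simp: p_eq q_eq M_mat_def split: if_splits)
          have "q \<in> D \<or> q \<in> B"
          proof (cases "j \<in> F")
            case True
            then have "d i + b \<le> d j + l"
              using d_edge[OF True l(2) b] False by (simp add: p_eq q_eq)
            then show ?thesis
              using True l b by (auto simp: D_def q_eq)
          next
            case False
            then show ?thesis
              using b near l dN[of i] by (auto simp: B_def q_eq)
          qed
          then have "y q \<le> w q"
            using t[of q] V_upper[of k q] by (auto simp: y_def w_def intro: order_trans)
          then have "?M p q \<otimes> y q \<le> ?M p q \<otimes> w q"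
            by (intro mp_times_mono order_refl)
          also have "\<dots> \<le> w p"
            using l b near dN[of i] Nt by (intro w_inv) (auto simp: p_eq q_eq mem_M_index)
          finally show ?thesis .
        qed simp
        show ?thesis
          using 1 2 by (auto simp: y_def)
      qed
      moreover have "window y 1 = x"
        using v_le_w[of "top_index _"] by (intro ext) (simp add: window_1 y_def v_top min_absorb1)
      ultimately have "y \<in> Ext k"
        by (simp add: Ext_def subinvariant_on_def)
      then have "v k p \<le> y p"
        by (rule v_le)
      then show ?thesis
        using p by (simp add: y_def)
    qed
    have "i \<in> F"
      using inf that by (auto simp: F_def)
    then have "(d i, i) \<in> D"
      using d by (auto simp: D_def)
    then have "V (d i, i) \<le> w (d i, i)"
      unfolding V_def by (intro SUP_least bounded)
    moreover have "w (d i, i) \<noteq> \<infinity>"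
      using v_Rmax[of t "(d i, i)"] by (simp add: w_def mp_times_def)
    ultimately show False
      using d[OF \<open>i \<in> F\<close>] by simp
  qed
  \<comment> \<open>No constraint concerns a block 0, but an extension must not take the value \<open>\<infinity>\<close> there either.\<close>
  define U where "U p = (if fst p \<ge> 1 then V p else -\<infinity>)" for p
  have U: "U \<in> Rmax_vec"
    using V_fin by (auto simp: U_def Rmax_vec_def Rmax_def)
  have "subinvariant_on (M_index \<infinity>) ?M U"
    unfolding subinvariant_on_def U_def using V_inv by (auto simp: M_index_def)
  moreover have "window U 1 = x"
  proof
    fix p :: "'n + 'n"
    have "fst (top_index p) \<ge> 1"
      by (cases p) auto
    then show "window U 1 p = x p"
      by (simp add: window_1 U_def V_top)
  qed
  ultimately show ?thesis
    unfolding extensible_def using U by blast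
qed

lemma phi_iter_eq_extensible:
  fixes L C R :: "'n::finite \<Rightarrow> 'n \<Rightarrow> ereal"
  shows "phi_iter A_bar B_bar k (K_set L C R) = extensible L C R (k + 2)"
proof (cases k)
  case (enat j)
  then show ?thesis
    by (simp add: phi_iter_def phi_power_eq_extensible numeral_eq_enat)
next
  case infinity
  have "extensible L C R \<infinity> \<subseteq> extensible L C R (enat j)" for j
    using M_index_mono[of "enat j" \<infinity>] unfolding extensible_def subinvariant_on_def
    by simp blast
  then have "(\<Inter>j. extensible L C R (enat (j + 2))) = extensible L C R \<infinity>"
    by (intro equalityI subsetI INT_I extensible_infinity) (auto elim: INT_D)
  then show ?thesis
    by (simp add: infinity phi_iter_def phi_power_eq_extensible)
qed

section \<open>The maximal invariant subsemimodule\<close>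

lemma extensible_semimodule: "semimodule (extensible L C R K)"
proof -
  have eqs: "window (sup v w) a = sup (window v a) (window w a)"
    "window (\<lambda>p. c \<otimes> v p) a = (\<lambda>p. c \<otimes> window v a p)"
    "window (\<lambda>_. -\<infinity>) a = (\<lambda>_. -\<infinity>)" for v w :: "nat \<times> 'a \<Rightarrow> ereal" and a c
    by (auto simp: window_def fun_eq_iff split: sum.splits)
  have Rm: "sup v w \<in> Rmax_vec" "(\<lambda>p. c \<otimes> v p) \<in> Rmax_vec"
    if "v \<in> Rmax_vec" "w \<in> Rmax_vec" "c \<in> Rmax" for v w :: "nat \<times> 'a \<Rightarrow> ereal" and c
    using that by (auto simp: Rmax_vec_def mp_times_Rmax sup_ereal_def) (auto simp: Rmax_def max_def)
  have sup: "subinvariant_on I A (sup v w)"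
    if "subinvariant_on I A v" "subinvariant_on I A w" for I :: "(nat \<times> 'a) set" and A v w
    unfolding subinvariant_on_def
  proof (intro ballI)
    fix p q assume "p \<in> I" "q \<in> I"
    then have "A p q \<otimes> v q \<le> v p" "A p q \<otimes> w q \<le> w p"
      using that by (auto dest: subinvariant_onD)
    then show "A p q \<otimes> (sup v w) q \<le> (sup v w) p"
      by (auto simp: sup_max max_def intro: order_trans)
  qed
  have scale: "subinvariant_on I A (\<lambda>p. c \<otimes> v p)"
    if "subinvariant_on I A v" for I :: "(nat \<times> 'a) set" and A v c
    unfolding subinvariant_on_def
  proof (intro ballI)
    fix p q assume "p \<in> I" "q \<in> I"
    then have "c \<otimes> (A p q \<otimes> v q) \<le> c \<otimes> v p"
      by (intro mp_times_mono order_refl subinvariant_onD[OF that])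
    then show "A p q \<otimes> (c \<otimes> v q) \<le> c \<otimes> v p"
      by (metis mp_times_assoc mp_times_commute)
  qed
  have zero: "(\<lambda>_. -\<infinity>) \<in> extensible L C R K"
    unfolding extensible_def
    by (rule CollectI, rule exI[of _ "\<lambda>_. -\<infinity>"])
       (simp add: eqs Rmax_vec_def Rmax_def subinvariant_on_def)
  have "x \<in> Rmax_vec" if "x \<in> extensible L C R K" for x
    using that by (auto simp: extensible_def Rmax_vec_def window_def split: sum.splits)
  moreover have "sup x y \<in> extensible L C R K"
    if x: "x \<in> extensible L C R K" and y: "y \<in> extensible L C R K" for x y
  proof -
    obtain v w where "x = window v 1" "y = window w 1"
      and vw: "v \<in> Rmax_vec" "w \<in> Rmax_vec"
        "subinvariant_on (M_index K) (M_mat L C R) v" "subinvariant_on (M_index K) (M_mat L C R) w"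
      using x y by (auto simp: extensible_def)
    then have "sup x y = window (sup v w) 1"
      by (simp add: eqs)
    moreover have "(0::ereal) \<in> Rmax"
      by (simp add: Rmax_def)
    ultimately show ?thesis
      unfolding extensible_def using Rm(1) vw sup by blast
  qed
  moreover have "(\<lambda>i. c \<otimes> x i) \<in> extensible L C R K"
    if c: "c \<in> Rmax" and x: "x \<in> extensible L C R K" for c x
  proof -
    obtain v where "x = window v 1"
      and v: "v \<in> Rmax_vec" "subinvariant_on (M_index K) (M_mat L C R) v"
      using x by (auto simp: extensible_def)
    then have "(\<lambda>i. c \<otimes> x i) = window (\<lambda>p. c \<otimes> v p) 1"
      by (simp add: eqs)
    then show ?thesis
      unfolding extensible_def using Rm(2) v scale c by blast
  qed
  ultimately show ?thesis
    using zero by (auto simp: semimodule_def)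
qed

text \<open>
  Use the later blocks of an infinite extension as inputs. The state at time \<open>k\<close> is then the window at block
  \<open>k + 1\<close>, and deleting the first \<open>k\<close> blocks leaves an infinite extension of it. For finite \<open>K\<close> the deletion would
  shorten the extension.
\<close>

lemma extensible_infinity_AB_invariant: "AB_invariant A_bar B_bar (extensible L C R \<infinity>)"
  unfolding AB_invariant_def
proof
  fix x assume "x \<in> extensible L C R \<infinity>"
  then obtain v where x: "x = window v 1" and v: "v \<in> Rmax_vec"
    and inv: "subinvariant_on (M_index \<infinity>) (M_mat L C R) v"
    by (auto simp: extensible_def)
  define u where "u k i = v (k + 3, i)" for k i
  have traj: "trajectory A_bar B_bar x u k = window v (k + 1)" for k
  proof (induction k)
    case 0
    then show ?case
      by (simp add: x)
  next
    case (Suc k)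
    show ?case
      unfolding trajectory.simps A_bar_B_bar_step Suc
      by (rule ext) (simp add: u_def window_def eval_nat_numeral split: sum.splits)
  qed
  have "window v (k + 1) \<in> extensible L C R \<infinity>" for k
  proof -
    define w where "w = (\<lambda>(a, i). v (a + k, i))"
    have "w \<in> Rmax_vec"
      using v by (auto simp: w_def Rmax_vec_def)
    moreover have "subinvariant_on (M_index \<infinity>) (M_mat L C R) w"
      unfolding subinvariant_on_def w_def
      using subinvariant_onD[OF inv, of "(_ + k, _)" "(_ + k, _)"]
      by (auto simp: mem_M_index M_mat_shift)
    moreover have "window w 1 = window v (k + 1)"
      by (rule ext) (simp add: w_def window_def split: sum.splits)
    ultimately show ?thesis
      unfolding extensible_def by force
  qed
  then show "\<exists>u. (\<forall>k. u k \<in> Rmax_vec) \<and> (\<forall>k. trajectory A_bar B_bar x u k \<in> extensible L C R \<infinity>)"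
    using traj v by (intro exI[of _ u]) (auto simp: u_def Rmax_vec_def)
qed

text \<open>
  A state of an invariant set has a successor in the set, so each application of \<open>\<phi>\<close> keeps it.
\<close>

lemma AB_invariant_subset_phi_power:
  assumes "Y \<subseteq> Rmax_vec" "AB_invariant A B Y" "Y \<subseteq> X"
  shows "Y \<subseteq> (phi A B ^^ k) X"
proof (induction k)
  case (Suc k)
  show ?case
  proof
    fix y assume y: "y \<in> Y"
    then obtain u where u: "\<And>k. u k \<in> Rmax_vec" "\<And>k. trajectory A B y u k \<in> Y"
      using assms(2) unfolding AB_invariant_def by blast
    have "sup (A \<otimes>v y) (B \<otimes>v u 0) \<in> Y"
      using u(2)[of 1] by simp
    then show "y \<in> (phi A B ^^ Suc k) X"
      using Suc y u(1) assms(1) unfolding funpow.simps comp_def phi_def[of A B "(phi A B ^^ k) X"]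
      by blast
  qed
qed (use assms in simp)

theorem theorem5:
  fixes L C R :: "'n::finite \<Rightarrow> 'n \<Rightarrow> ereal"
  assumes "L \<in> Rmax_mat" and "C \<in> Rmax_mat" and "R \<in> Rmax_mat"
  shows "is_maximal_AB_invariant A_bar B_bar (K_set L C R)
           (phi_iter A_bar B_bar \<infinity> (K_set L C R))
       \<and> (mp_star_on UNIV (H_mat L C R) \<in> Rmax_mat \<longrightarrow>
             K_set L C R = mp_Im (mp_star_on UNIV (H_mat L C R)))
       \<and> (\<forall>k::enat. S_mat L C R (k + 2) \<in> Rmax_mat \<longrightarrow>
             phi_iter A_bar B_bar k (K_set L C R) = mp_Im (S_mat L C R (k + 2)))"
proof (intro conjI impI allI)
  have phi_inf: "phi_iter A_bar B_bar \<infinity> (K_set L C R) = extensible L C R \<infinity>"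
    using phi_iter_eq_extensible[of \<infinity> L C R] by simp
  have Inter: "phi_iter A_bar B_bar \<infinity> (K_set L C R) = (\<Inter>j. (phi A_bar B_bar ^^ j) (K_set L C R))"
    by (simp add: phi_iter_def)
  show "is_maximal_AB_invariant A_bar B_bar (K_set L C R)
          (phi_iter A_bar B_bar \<infinity> (K_set L C R))"
    unfolding is_maximal_AB_invariant_def
  proof (intro conjI allI impI)
    show "semimodule (phi_iter A_bar B_bar \<infinity> (K_set L C R))"
      unfolding phi_inf by (rule extensible_semimodule)
    show "AB_invariant A_bar B_bar (phi_iter A_bar B_bar \<infinity> (K_set L C R))"
      unfolding phi_inf by (rule extensible_infinity_AB_invariant)
    show "phi_iter A_bar B_bar \<infinity> (K_set L C R) \<subseteq> K_set L C R"
      unfolding Inter using INF_lower[of 0 UNIV "\<lambda>j. (phi A_bar B_bar ^^ j) (K_set L C R)"] by simp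
    show "Y \<subseteq> phi_iter A_bar B_bar \<infinity> (K_set L C R)"
      if "semimodule Y \<and> AB_invariant A_bar B_bar Y \<and> Y \<subseteq> K_set L C R" for Y
      unfolding Inter
      by (intro INT_greatest AB_invariant_subset_phi_power) (use that in \<open>auto simp: semimodule_def\<close>)
  qed
next
  show "K_set L C R = mp_Im (mp_star_on UNIV (H_mat L C R))"
    if "mp_star_on UNIV (H_mat L C R) \<in> Rmax_mat"
    using that by (rule K_set_eq_mp_Im_star)
next
  fix k :: enat
  assume S: "S_mat L C R (k + 2) \<in> Rmax_mat"
  have fin: "mp_Im (S_mat L C R (k + 2)) \<subseteq> (phi A_bar B_bar ^^ j) (K_set L C R)"
    if j: "enat j \<le> k" for j
  proof -
    have le: "(2::enat) \<le> enat (j + 2)" "enat (j + 2) \<le> k + 2"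
      using j add_right_mono[OF j, of 2] by (auto simp: numeral_eq_enat)
    show ?thesis
      using mp_Im_S_mat_antimono[OF S le] mp_Im_S_mat_subset_phi_power
        S_mat_Rmax_antimono[OF le S] by blast
  qed
  show "phi_iter A_bar B_bar k (K_set L C R) = mp_Im (S_mat L C R (k + 2))"
  proof
    show "phi_iter A_bar B_bar k (K_set L C R) \<subseteq> mp_Im (S_mat L C R (k + 2))"
      unfolding phi_iter_eq_extensible by (rule extensible_subset_mp_Im_S_mat) (use S in auto)
    show "mp_Im (S_mat L C R (k + 2)) \<subseteq> phi_iter A_bar B_bar k (K_set L C R)"
      using fin by (cases k) (auto simp: phi_iter_def)
  qed
qed

end
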